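(* There exists an absolute constant $c_1>0$ with the following property. Let $3=p_1<p_2<\cdots$ be the increasing sequence of odd primes, and let $(\varepsilon_i)_{i\ge1}$ be any sequence with $\varepsilon_i\in\{0,1\}$. Then for every sufficiently large real $x$ there exists a positive integer $n<x$ such that $$e_{p_i}(n)\equiv\varepsilon_i\pmod 2\quad\text{for all } i=1,\dots,k(x),\qquad\text{where } k(x):=\Bigl\lfloor c_1\Bigl(\frac{\log x}{(\log\log x)^6}\Bigr)^{1/9}\Bigr\rfloor .$$
   Context: For a prime $p$ and a non-negative integer $n$, $e_p(n)$ denotes the exponent of $p$ in the prime factorization of $n!$. *)

theory Defs
  imports "HOL-Analysis.Analysis" "HOL-Computational_Algebra.Primes" "HOL-Library.Infinite_Set"
begin

definition e_fact :: "nat \<Rightarrow> nat \<Rightarrow> nat" where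
  "e_fact p n = multiplicity p (fact n :: nat)"

text \<open>The i-th odd prime, 1-indexed: odd_prime 1 = 3, odd_prime 2 = 5, ...\<close>
definition odd_prime :: "nat \<Rightarrow> nat" where
  "odd_prime i = enumerate {p. prime p \<and> odd p} (i - 1)"

definition k_fun :: "real \<Rightarrow> real \<Rightarrow> nat" where
  "k_fun c x = nat \<lfloor>c * (ln x / (ln (ln x)) ^ 6) powr (1/9)\<rfloor>"

end

theory Submission
  imports Defs "HOL-Number_Theory.Cong" "HOL-Computational_Algebra.Squarefree"
begin

text \<open>
  For odd \<open>p\<close> the sign \<open>f\<^sub>p(n) = (-1)^e\<^sub>p(n)\<close> is a product of signs attached to the base-\<open>p\<close>
  digits of \<open>n\<close> in odd positions. Its autocorrelation therefore satisfies a two-term recursion over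
  pairs of digits, whose \<open>L\<^sup>1\<close> mean over the shifts contracts by a factor at most \<open>7/9\<close> per pair.
  For a finite set \<open>P\<close> of odd primes choose residues \<open>a\<^sub>p\<close> at random, independently. By the contraction
  and a second moment estimate, some choice makes every sum of \<open>\<Prod>p\<in>S. f\<^sub>p(a\<^sub>p + h)\<close> over \<open>h < H\<close>,
  with \<open>S \<subseteq> P\<close> nonempty, smaller than \<open>H / 2^|P|\<close>; hence every sign pattern on \<open>P\<close>
  occurs among the shifts \<open>h < H\<close>. The Chinese remainder theorem gives \<open>m\<close> whose low digits in each
  base \<open>p\<close> are those of \<open>a\<^sub>p\<close>, followed by zeros that absorb the carries; the high digits only multiply the
  pattern by a fixed sign for each \<open>p\<close>. For the first \<open>k\<close> odd primes this gives \<open>n = m + h < 2^(586 k^5)\<close>,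
  well below what is needed.
\<close>

section \<open>Sums split by digits and over whole periods\<close>

text \<open>Separates the lowest base-\<open>p\<close> digit \<open>d\<close> of the index from the
  higher part \<open>m\<close>; used twice, it exposes a pair of digits.\<close>

lemma sum_lessThan_mult:
  fixes F :: "nat \<Rightarrow> 'a::comm_monoid_add"
  shows "(\<Sum>n<p*Q. F n) = (\<Sum>m<Q. \<Sum>d<p. F (d + p*m))"
proof -
  have "(\<Sum>n<Q*p. F n) = (\<Sum>m<Q. sum F {m*p..<m*p+p})"
    by (rule sum.nat_group[symmetric])
  also have "\<dots> = (\<Sum>m<Q. \<Sum>d<p. F (d + p*m))"
  proof (rule sum.cong)
    fix m
    show "sum F {m*p..<m*p+p} = (\<Sum>d<p. F (d + p*m))"
      using sum.shift_bounds_nat_ivl[of F 0 "m*p" p]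
      by (simp add: atLeast0LessThan mult.commute add.commute)
  qed simp
  finally show ?thesis by (simp add: mult.commute)
qed

lemma periodic_mult:
  fixes g :: "nat \<Rightarrow> 'a"
  assumes "\<And>n. g (n + Q) = g n"
  shows "g (n + Q*m) = g n"
proof (induction m)
  case (Suc m)
  have "g (n + Q * Suc m) = g (n + Q*m + Q)" by (simp add: algebra_simps)
  then show ?case using assms Suc by simp
qed simp

text \<open>Moving a window of one period by one exchanges \<open>g c\<close> for the equal
  \<open>g (c + Q)\<close>, so its starting point does not matter.\<close>

lemma sum_periodic_window:
  fixes g :: "nat \<Rightarrow> real"
  assumes per: "\<And>n. g (n + Q) = g n"
  shows "(\<Sum>n<Q*K. g (n + c)) = real K * (\<Sum>n<Q. g n)"
proof -
  have shift: "(\<Sum>n<Q. g (n + c)) = (\<Sum>n<Q. g n)" for c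
  proof (induction c)
    case (Suc c)
    have "(\<Sum>n<Q. g (n + Suc c)) + g c = (\<Sum>n<Suc Q. g (n + c))"
      by (subst sum.lessThan_Suc_shift) simp
    also have "\<dots> = (\<Sum>n<Q. g (n + c)) + g c"
      using per[of c] by (simp add: add.commute)
    finally show ?case using Suc by simp
  qed simp
  have "(\<Sum>n<Q*K. g (n + c)) = (\<Sum>m<K. \<Sum>d<Q. g (d + c + Q*m))"
    by (subst sum_lessThan_mult) (simp add: ac_simps)
  then show ?thesis by (simp add: periodic_mult[of g, OF per] shift)
qed

section \<open>Legendre's recursion and the digit signs\<close>

text \<open>Legendre's formula in recursive form. From \<open>m\<close> to \<open>Suc m\<close> both
  sides change only if \<open>Suc m = p * Suc j\<close> for some \<open>j\<close>, and then the
  multiplicity of \<open>p\<close> in \<open>Suc m\<close> is one more than in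
  \<open>Suc j\<close>.\<close>

lemma e_fact_div:
  assumes "prime p"
  shows "e_fact p m = m div p + e_fact p (m div p)"
proof (induction m)
  case 0
  then show ?case by (simp add: e_fact_def)
next
  case (Suc m)
  have p: "p > 0" "prime_elem p" using assms prime_gt_0_nat by auto
  have step: "e_fact p (Suc j) = multiplicity p (Suc j) + e_fact p j" for j
    unfolding e_fact_def fact_Suc of_nat_id
    by (rule prime_elem_multiplicity_mult_distrib[OF p(2)]) auto
  show ?case
  proof (cases "p dvd Suc m")
    case False
    then have "Suc m div p = m div p"
      by (simp add: div_Suc dvd_eq_mod_eq_0)
    then show ?thesis
      using Suc step[of m] not_dvd_imp_multiplicity_0[OF False] by simp
  next
    case True
    then obtain j0 where j0: "Suc m = p * j0" by blast
    then obtain j where j: "j0 = Suc j" by (cases j0) auto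
    have jm: "Suc m div p = Suc j" using j0 j p by simp
    have mj: "m div p = j"
      using True jm by (simp add: div_Suc dvd_eq_mod_eq_0)
    have "multiplicity p (Suc m) = Suc (multiplicity p (Suc j))"
      unfolding j0 j using assms
      by (intro multiplicity_times_same) (auto simp: not_prime_unit)
    then show ?thesis
      using Suc step[of m] step[of j] by (simp add: jm mj)
  qed
qed

definition fact_sign :: "nat \<Rightarrow> nat \<Rightarrow> real" where
  "fact_sign p n = (-1) ^ e_fact p n"

lemma abs_fact_sign [simp]: "\<bar>fact_sign p n\<bar> = 1"
  by (simp add: fact_sign_def power_abs)

text \<open>Since p is odd, only the base-p digits in odd positions contribute to the parity.\<close>
lemma fact_sign_div:
  assumes "prime p" "odd p"
  shows "fact_sign p m = (-1) ^ (m div p mod p) * fact_sign p (m div p\<^sup>2)"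
proof -
  define a where "a = m div p"
  have "m div p\<^sup>2 = a div p" by (simp add: a_def power2_eq_square div_mult2_eq)
  then have e: "e_fact p m = a + a div p + e_fact p (m div p\<^sup>2)"
    using e_fact_div[OF assms(1), of m] e_fact_div[OF assms(1), of a] by (simp add: a_def)
  \<comment> \<open>\<open>a + a div p\<close> equals \<open>(p + 1) * (a div p) + a mod p\<close>,
    and \<open>p + 1\<close> is even.\<close>
  have "even (a + a div p) = even (a mod p)"
    using assms(2) by (metis div_mult_mod_eq even_add even_mult_iff)
  then have "(-1::real) ^ (a + a div p) = (-1) ^ (a mod p)"
    by (simp add: minus_one_power_iff)
  then show ?thesis
    by (simp add: fact_sign_def e power_add a_def)
qed

lemma fact_sign_less:
  assumes "prime p" "b < p"
  shows "fact_sign p b = 1"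
  using e_fact_div[OF assms(1), of b] assms(2) by (simp add: fact_sign_def e_fact_def)

text \<open>The contribution of the lowest \<open>2 * r\<close> digits alone. Dropping the higher
  digits makes it periodic, so that its shifts can be correlated over a full period.\<close>

fun trunc_sign :: "nat \<Rightarrow> nat \<Rightarrow> nat \<Rightarrow> real" where
  "trunc_sign p 0 n = 1"
| "trunc_sign p (Suc r) n = (-1) ^ (n div p mod p) * trunc_sign p r (n div p\<^sup>2)"

lemma abs_trunc_sign [simp]: "\<bar>trunc_sign p r n\<bar> = 1"
  by (induction r arbitrary: n) (simp_all add: abs_mult power_abs)

lemma fact_sign_trunc:
  assumes "prime p" "odd p"
  shows "fact_sign p n = trunc_sign p r n * fact_sign p (n div p ^ (2*r))"
proof (induction r arbitrary: n)
  case (Suc r)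
  have "n div p\<^sup>2 div p ^ (2*r) = n div p ^ (2 * Suc r)"
    by (simp add: div_mult2_eq[symmetric] power_add[symmetric])
  then show ?case
    using Suc[of "n div p\<^sup>2"] fact_sign_div[OF assms, of n] by simp
qed simp

lemma trunc_sign_periodic:
  assumes "p > 0"
  shows "trunc_sign p r (n + p ^ (2*r)) = trunc_sign p r n"
proof (induction r arbitrary: n)
  case (Suc r)
  have e1: "(n + p ^ (2 * Suc r)) div p = n div p + p * p ^ (2*r)"
    using assms div_mult_self2[of p n "p * p ^ (2*r)"] by simp
  have "p ^ (2 * Suc r) = p\<^sup>2 * p ^ (2*r)" by (simp add: power2_eq_square)
  then have e2: "(n + p ^ (2 * Suc r)) div p\<^sup>2 = n div p\<^sup>2 + p ^ (2*r)"
    using assms by (simp only: div_mult_self2) simp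
  show ?case by (simp only: trunc_sign.simps e1 e2 Suc) simp
qed simp

section \<open>Autocorrelation and its recursion over digit pairs\<close>

definition autocorr :: "nat \<Rightarrow> (nat \<Rightarrow> real) \<Rightarrow> nat \<Rightarrow> real" where
  "autocorr Q u h = (\<Sum>n<Q. u n * u (n + h))"

text \<open>Adding \<open>a\<close> to the lowest digit \<open>d\<close> causes no carry when
  \<open>d < p - a\<close>; otherwise the digit becomes \<open>d + a - p\<close> and the carry
  raises the shift of the higher part to \<open>h + 1\<close>.\<close>

lemma autocorr_digit:
  assumes u: "\<And>n. u n = \<sigma> (n mod p) * w (n div p)" and a: "a < p"
  shows "autocorr (p*Q) u (a + p*h) =
    (\<Sum>d<p-a. \<sigma> d * \<sigma> (d+a)) * autocorr Q w h +
    (\<Sum>d\<in>{p-a..<p}. \<sigma> d * \<sigma> (d+a-p)) * autocorr Q w (h+1)"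
proof -
  have split: "(\<Sum>d<p. F d) = (\<Sum>d<p-a. F d) + (\<Sum>d\<in>{p-a..<p}. F d)" for F :: "nat \<Rightarrow> real"
    by (subst sum.union_disjoint[symmetric]) (auto intro!: sum.cong)
  have inner: "(\<Sum>d<p. u (d + p*m) * u (d + p*m + (a + p*h))) =
      (\<Sum>d<p-a. \<sigma> d * \<sigma> (d+a)) * (w m * w (m+h)) +
      (\<Sum>d\<in>{p-a..<p}. \<sigma> d * \<sigma> (d+a-p)) * (w m * w (m+(h+1)))" for m
  proof -
    have u0: "u (d + p*m) = \<sigma> d * w m" if "d < p" for d m
      using that by (simp add: u)
    have low: "u (d + p*m + (a + p*h)) = \<sigma> (d+a) * w (m+h)" if "d < p - a" for d
    proof -
      have "d + p*m + (a + p*h) = (d+a) + p*(m+h)" by (simp add: algebra_simps)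
      then show ?thesis using that u0[of "d+a" "m+h"] by (metis less_diff_conv)
    qed
    have high: "u (d + p*m + (a + p*h)) = \<sigma> (d+a-p) * w (m+(h+1))"
      if "d \<in> {p-a..<p}" for d
    proof -
      have "d + p*m + (a + p*h) = (d+a-p) + p*(m+(h+1))"
        using that a by (auto simp: algebra_simps)
      moreover have "d+a-p < p" using that a by auto
      ultimately show ?thesis using u0[of "d+a-p" "m+(h+1)"] by simp
    qed
    show ?thesis
      unfolding split sum_distrib_right
      by (intro arg_cong2[of _ _ _ _ "(+)"] sum.cong)
        (use u0 low high a in \<open>auto simp: algebra_simps\<close>)
  qed
  show ?thesis
    unfolding autocorr_def sum_lessThan_mult inner
    by (simp add: sum.distrib sum_distrib_left)
qed

text \<open>A digit in an even position has no sign, so the weights just count the digits without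
  and with a carry.\<close>

lemma autocorr_even_digit:
  assumes "a < p" "\<And>n. u n = w (n div p)"
  shows "autocorr (p*Q) u (a + p*h) =
    (real p - real a) * autocorr Q w h + real a * autocorr Q w (h+1)"
  using autocorr_digit[of u "\<lambda>_. 1" p w a Q h] assms by (simp add: of_nat_diff)

lemma autocorr_odd_digit:
  assumes "odd p" "a \<le> p" and u: "\<And>n. u n = (-1) ^ (n mod p) * w (n div p)"
  shows "autocorr (p*Q) u (a + p*h) =
    (-1) ^ a * ((real p - real a) * autocorr Q w h - real a * autocorr Q w (h+1))"
proof -
  have lt: "autocorr (p*Q) u (a + p*h) =
      (-1) ^ a * ((real p - real a) * autocorr Q w h - real a * autocorr Q w (h+1))"
    if a: "a < p" for a h
  proof -
    have "(\<Sum>d<p-a. (-1) ^ d * (-1::real) ^ (d+a)) = (\<Sum>d<p-a. (-1) ^ a)"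
      by (intro sum.cong) (auto simp: minus_one_power_iff)
    then have low: "(\<Sum>d<p-a. (-1) ^ d * (-1::real) ^ (d+a)) = (real p - real a) * (-1) ^ a"
      using a by (simp add: of_nat_diff)
    have "(\<Sum>d\<in>{p-a..<p}. (-1) ^ d * (-1::real) ^ (d+a-p)) = (\<Sum>d\<in>{p-a..<p}. - ((-1) ^ a))"
    proof (intro sum.cong refl)
      fix d assume d: "d \<in> {p-a..<p}"
      then have "even (d+a-p) \<longleftrightarrow> \<not> even (d+a)"
        using assms(1) a by (subst even_diff_nat) auto
      then show "(-1) ^ d * (-1::real) ^ (d+a-p) = - ((-1) ^ a)"
        by (auto simp: minus_one_power_iff)
    qed
    then have high: "(\<Sum>d\<in>{p-a..<p}. (-1) ^ d * (-1::real) ^ (d+a-p)) = - real a * (-1) ^ a"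
      using a by simp
    show ?thesis
      unfolding autocorr_digit[of u "\<lambda>d. (-1) ^ d" p w a Q h, OF u a] low high
      by (simp add: algebra_simps)
  qed
  show ?thesis
  proof (cases "a = p")
    \<comment> \<open>Here the shift is \<open>0 + p * (h + 1)\<close>, which the case of digit 0
      covers; the signs agree because \<open>(-1) ^ p = -1\<close>.\<close>
    case True
    have "p > 0" using assms(1) by (rule odd_pos)
    from lt[OF this, of "h+1"] show ?thesis using True assms(1) by simp
  qed (use assms lt in auto)
qed

text \<open>A carry out of the even digit turns \<open>b\<close> into \<open>b + 1\<close> and so
  reverses the sign of the odd digit. The resulting cancellation, which replaces
  \<open>p - a\<close> by \<open>p - 2 * a\<close>, is the source of the contraction.\<close>

lemma autocorr_trunc_Suc:
  assumes p: "odd p" and a: "a < p" "b < p"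
  shows "autocorr (p ^ (2 * Suc r)) (trunc_sign p (Suc r)) (a + p * (b + p*h)) =
    (-1) ^ b *
     (((real p - 2 * real a) * (real p - real b) + real a) *
        autocorr (p ^ (2*r)) (trunc_sign p r) h +
      (real a - (real p - 2 * real a) * real b) *
        autocorr (p ^ (2*r)) (trunc_sign p r) (h+1))"
proof -
  define v where "v n = (-1) ^ (n mod p) * trunc_sign p r (n div p)" for n
  define Q where "Q = p ^ (2*r)"
  define c where "c = autocorr Q (trunc_sign p r)"
  have Q2: "p ^ (2 * Suc r) = p * (p * Q)" by (simp add: Q_def)
  have even: "autocorr (p * (p*Q)) (trunc_sign p (Suc r)) (a + p * (b + p*h)) =
      (real p - real a) * autocorr (p*Q) v (b + p*h) +
      real a * autocorr (p*Q) v (b + p*h + 1)"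
    by (rule autocorr_even_digit) (use a in \<open>auto simp: v_def power2_eq_square div_mult2_eq\<close>)
  have odd: "autocorr (p*Q) v (b' + p*h) =
      (-1) ^ b' * ((real p - real b') * c h - real b' * c (h+1))" if "b' \<le> p" for b'
    unfolding c_def by (rule autocorr_odd_digit[OF p that]) (simp add: v_def)
  have odd1: "autocorr (p*Q) v (b + p*h + 1) =
      - ((-1) ^ b) * ((real p - (real b + 1)) * c h - (real b + 1) * c (h+1))"
    using odd[of "Suc b"] a by (simp add: add.commute)
  have odd0: "autocorr (p*Q) v (b + p*h) =
      (-1) ^ b * ((real p - real b) * c h - real b * c (h+1))"
    using odd[of b] a by simp
  show ?thesis
    unfolding Q2 even odd0 odd1 Q_def[symmetric] c_def[symmetric] by (simp add: algebra_simps)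
qed

section \<open>The majorant and its contraction in mean\<close>

text \<open>\<open>majX\<close> and \<open>majY\<close> are the absolute values of the two
  coefficients in \<open>autocorr_trunc_Suc\<close>.\<close>

definition majX :: "nat \<Rightarrow> nat \<Rightarrow> nat \<Rightarrow> real" where
  "majX p a b = \<bar>(real p - 2 * real a) * (real p - real b) + real a\<bar>"

definition majY :: "nat \<Rightarrow> nat \<Rightarrow> nat \<Rightarrow> real" where
  "majY p a b = \<bar>real a - (real p - 2 * real a) * real b\<bar>"

text \<open>A majorant of the normalised autocorrelation depending only on the lowest \<open>2s\<close> digits of the
  shift, so that it can be averaged over windows of shifts shorter than the full period.\<close>
fun maj :: "nat \<Rightarrow> nat \<Rightarrow> nat \<Rightarrow> real" where
  "maj p 0 h = 1"
| "maj p (Suc s) h =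
    (majX p (h mod p) (h div p mod p) * maj p s (h div p\<^sup>2) +
     majY p (h mod p) (h div p mod p) * maj p s (h div p\<^sup>2 + 1)) / (real p)\<^sup>2"

lemma maj_nonneg: "maj p s h \<ge> 0"
  by (induction s arbitrary: h) (auto simp: majX_def majY_def)

lemma maj_periodic:
  assumes "p > 0"
  shows "maj p s (h + p ^ (2 * s)) = maj p s h"
proof (induction s arbitrary: h)
  case (Suc s)
  have P: "p ^ (2 * Suc s) = p\<^sup>2 * p ^ (2 * s)" "p ^ (2 * Suc s) = p * (p * p ^ (2 * s))"
    by (simp_all add: power2_eq_square)
  have e1: "(h + p ^ (2 * Suc s)) div p = h div p + p * p ^ (2 * s)"
    unfolding P(2) using assms by simp
  have e2: "(h + p ^ (2 * Suc s)) div p\<^sup>2 = h div p\<^sup>2 + p ^ (2 * s)"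
    unfolding P(1) using assms by simp
  have e3: "(h + p ^ (2 * Suc s)) mod p = h mod p"
    unfolding P(2) by simp
  have e4: "h div p\<^sup>2 + p ^ (2 * s) + 1 = h div p\<^sup>2 + 1 + p ^ (2 * s)" by simp
  show ?case by (simp only: maj.simps e1 e2 e3 e4 Suc) simp
qed simp

text \<open>The recursion is applied \<open>s\<close> times, and the autocorrelation of the
  remaining \<open>r - s\<close> digit pairs is bounded trivially by its number of terms.\<close>

lemma autocorr_trunc_le_maj:
  assumes "odd p" "s \<le> r"
  shows "\<bar>autocorr (p ^ (2*r)) (trunc_sign p r) h\<bar> \<le> real p ^ (2*r) * maj p s h"
  using assms(2)
proof (induction s arbitrary: r h)
  case 0
  have "\<bar>autocorr (p ^ (2*r)) (trunc_sign p r) h\<bar> \<le>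
      (\<Sum>n<p ^ (2*r). \<bar>trunc_sign p r n * trunc_sign p r (n + h)\<bar>)"
    unfolding autocorr_def by (rule sum_abs)
  then show ?case by (simp add: abs_mult)
next
  case (Suc s)
  have p: "p > 0" using assms(1) by (rule odd_pos)
  obtain r' where r: "r = Suc r'" "s \<le> r'" using Suc.prems by (cases r) auto
  define a b m where "a = h mod p" and "b = h div p mod p" and "m = h div p\<^sup>2"
  have ab: "a < p" "b < p" using p by (auto simp: a_def b_def)
  have h: "h = a + p * (b + p*m)"
    unfolding a_def b_def m_def power2_eq_square div_mult2_eq by simp
  define c where "c = autocorr (p ^ (2*r')) (trunc_sign p r')"
  have "\<bar>autocorr (p ^ (2*r)) (trunc_sign p r) h\<bar> =
      \<bar>((real p - 2 * real a) * (real p - real b) + real a) * c m +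
       (real a - (real p - 2 * real a) * real b) * c (m+1)\<bar>"
    unfolding r(1) c_def h autocorr_trunc_Suc[OF assms(1) ab] by (simp add: abs_mult power_abs)
  also have "\<dots> \<le> majX p a b * \<bar>c m\<bar> + majY p a b * \<bar>c (m+1)\<bar>"
    unfolding majX_def majY_def abs_mult[symmetric] by (rule abs_triangle_ineq)
  also have "\<dots> \<le> majX p a b * (real p ^ (2*r') * maj p s m) +
      majY p a b * (real p ^ (2*r') * maj p s (m+1))"
    unfolding c_def using Suc.IH[OF r(2)]
    by (intro add_mono mult_left_mono) (auto simp: majX_def majY_def)
  also have "\<dots> = real p ^ (2*r) * maj p (Suc s) h"
    unfolding maj.simps a_def[symmetric] b_def[symmetric] m_def[symmetric] r(1)
    using p by (simp add: field_simps power2_eq_square)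
  finally show ?case .
qed

text \<open>The terms are the odd numbers 1, ..., 2m+1 and again 1, ..., 2m-1, with sums
  \<open>(m + 1)^2\<close> and \<open>m^2\<close>.\<close>

lemma sum_abs_odd:
  "(\<Sum>a<2*m+1. \<bar>real (2*m+1) - 2 * real a\<bar>) = 2 * (real m)\<^sup>2 + 2 * real m + 1"
proof -
  have "(\<Sum>a<2*m+1. \<bar>real (2*m+1) - 2 * real a\<bar>) =
      (\<Sum>a<m+1. \<bar>real (2*m+1) - 2 * real a\<bar>) + (\<Sum>a\<in>{m+1..<2*m+1}. \<bar>real (2*m+1) - 2 * real a\<bar>)"
  proof -
    have "{..<2*m+1} = {..<m+1} \<union> {m+1..<2*m+1}" by auto
    then show ?thesis by (metis (no_types, lifting) finite_atLeastLessThan finite_lessThan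
        ivl_disj_int_one(2) sum.union_disjoint)
  qed
  also have "(\<Sum>a<m+1. \<bar>real (2*m+1) - 2 * real a\<bar>) = (\<Sum>a<m+1. real (2*m+1) - 2 * real a)"
    by (intro sum.cong) auto
  also have "\<dots> = (real m + 1)\<^sup>2"
  proof -
    have closed: "(\<Sum>a<k. c - 2 * real a) = real k * c - real k * (real k - 1)" for k and c :: real
      by (induction k) (auto simp: algebra_simps)
    show ?thesis unfolding closed by (simp add: algebra_simps power2_eq_square)
  qed
  also have "(\<Sum>a\<in>{m+1..<2*m+1}. \<bar>real (2*m+1) - 2 * real a\<bar>) = (\<Sum>i<m. 2 * real i + 1)"
    by (rule sum.reindex_bij_witness[of _ "\<lambda>i. i + (m+1)" "\<lambda>a. a - (m+1)"])
      (auto simp: of_nat_diff algebra_simps)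
  also have "\<dots> = (real m)\<^sup>2"
    by (induction m) (auto simp: algebra_simps power2_eq_square)
  finally show ?thesis by (simp add: power2_eq_square algebra_simps)
qed

text \<open>By the triangle inequality \<open>b\<close> enters the two terms with the weights
  \<open>p - b\<close> and \<open>b\<close>, so it disappears from the bound on their sum.\<close>

lemma sum_maj_coeffs:
  assumes "odd p" "p \<ge> 3"
  shows "(\<Sum>b<p. \<Sum>a<p. majX p a b + majY p a b) \<le> 7/9 * real p ^ 4"
proof -
  obtain m where m: "p = 2*m+1" using assms(1) by (rule oddE)
  have le: "majX p a b + majY p a b \<le> real p * \<bar>real p - 2 * real a\<bar> + 2 * real a" if "b < p" for a b
  proof -
    have "majX p a b \<le> \<bar>real p - 2 * real a\<bar> * (real p - real b) + real a"
      unfolding majX_def using abs_triangle_ineq[of "(real p - 2 * real a) * (real p - real b)" "real a"] that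
      by (simp add: abs_mult)
    moreover have "majY p a b \<le> real a + \<bar>real p - 2 * real a\<bar> * real b"
      unfolding majY_def using abs_triangle_ineq4[of "real a" "(real p - 2 * real a) * real b"]
      by (simp add: abs_mult)
    ultimately show ?thesis by (simp add: algebra_simps)
  qed
  have "(\<Sum>b<p. \<Sum>a<p. majX p a b + majY p a b) \<le>
      (\<Sum>b<p. \<Sum>a<p. real p * \<bar>real p - 2 * real a\<bar> + 2 * real a)"
    by (intro sum_mono le) auto
  also have "\<dots> = real p * (real p * (\<Sum>a<p. \<bar>real p - 2 * real a\<bar>) + (\<Sum>a<p. 2 * real a))"
    by (simp add: sum.distrib sum_distrib_left)
  also have "(\<Sum>a<p. 2 * real a) = real p * (real p - 1)"
    by (induction p) (auto simp: algebra_simps)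
  also have "(\<Sum>a<p. \<bar>real p - 2 * real a\<bar>) = 2 * (real m)\<^sup>2 + 2 * real m + 1"
    using sum_abs_odd[of m] unfolding m by simp
  also have "\<dots> = ((real p)\<^sup>2 + 1) / 2"
    unfolding m by (simp add: power2_eq_square algebra_simps)
  also have "real p * (real p * (((real p)\<^sup>2 + 1) / 2) + real p * (real p - 1)) \<le> 7/9 * real p ^ 4"
  proof -
    \<comment> \<open>The bound holds with equality at \<open>p = 3\<close>, which fixes the
      constant 7/9; in general the difference of the two sides is this product divided by
      18.\<close>
    have "0 \<le> (real p)\<^sup>2 * ((real p - 3) * (5 * real p - 3))"
      using assms(2) by (intro mult_nonneg_nonneg) auto
    then show ?thesis by (simp add: power2_eq_square power4_eq_xxxx field_simps)
  qed
  finally show ?thesis .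
qed

text \<open>By periodicity \<open>maj p s m\<close> and \<open>maj p s (m + 1)\<close> have the same
  sum over a period, so each digit pair multiplies the sum by at most \<open>7/9 * p^2\<close>,
  while the number of shifts grows by \<open>p^2\<close>.\<close>

lemma sum_maj:
  assumes "odd p" "p \<ge> 3"
  shows "(\<Sum>h<p ^ (2 * s). maj p s h) \<le> (7/9) ^ s * real p ^ (2 * s)"
proof (induction s)
  case (Suc s)
  have p: "p > 0" using assms by simp
  define T where "T = (\<Sum>m<p ^ (2 * s). maj p s m)"
  have T0: "T \<ge> 0" unfolding T_def by (intro sum_nonneg maj_nonneg)
  have T1: "(\<Sum>m<p ^ (2 * s). maj p s (m+1)) = T"
    using sum_periodic_window[of "maj p s" "p ^ (2 * s)" 1 1] maj_periodic[OF p] by (simp add: T_def)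
  have val: "maj p (Suc s) (a + p * (b + p*m)) =
      (majX p a b * maj p s m + majY p a b * maj p s (m+1)) / (real p)\<^sup>2"
    if "a < p" "b < p" for a b m
    using that by (simp add: power2_eq_square div_mult2_eq)
  have "(\<Sum>h<p ^ (2 * Suc s). maj p (Suc s) h) =
      (\<Sum>m<p ^ (2 * s). \<Sum>b<p. \<Sum>a<p. maj p (Suc s) (a + p * (b + p*m)))"
  proof -
    have P: "p ^ (2 * Suc s) = p * (p * p ^ (2 * s))" by simp
    show ?thesis unfolding P sum_lessThan_mult ..
  qed
  also have "\<dots> = (\<Sum>m<p ^ (2 * s). \<Sum>b<p. \<Sum>a<p.
      (majX p a b * maj p s m + majY p a b * maj p s (m+1)) / (real p)\<^sup>2)"
    by (intro sum.cong refl val) auto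
  also have "\<dots> = (\<Sum>b<p. \<Sum>a<p. \<Sum>m<p ^ (2 * s).
      (majX p a b * maj p s m + majY p a b * maj p s (m+1)) / (real p)\<^sup>2)"
    by (subst sum.swap, rule sum.cong[OF refl], rule sum.swap)
  also have "\<dots> = (\<Sum>b<p. \<Sum>a<p. (majX p a b + majY p a b) * T / (real p)\<^sup>2)"
    unfolding sum_divide_distrib[symmetric] sum.distrib sum_distrib_left[symmetric] T1 T_def[symmetric]
    by (simp add: distrib_right sum.distrib)
  also have "\<dots> = (\<Sum>b<p. \<Sum>a<p. majX p a b + majY p a b) * T / (real p)\<^sup>2"
    by (simp only: sum_divide_distrib sum_distrib_right)
  also have "\<dots> \<le> (7/9 * real p ^ 4) * ((7/9) ^ s * real p ^ (2 * s)) / (real p)\<^sup>2"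
    using Suc T0 unfolding T_def[symmetric]
    by (intro divide_right_mono mult_mono sum_maj_coeffs assms) auto
  also have "\<dots> = (7/9) ^ Suc s * real p ^ (2 * Suc s)"
    using p by (simp add: field_simps power2_eq_square power4_eq_xxxx)
  finally show ?case .
qed simp

section \<open>Second moments over random residues\<close>

text \<open>For fixed \<open>h\<close> the correlation depends on \<open>h' - h\<close>. As
  \<open>h'\<close> varies, the shifts fill whole periods of the majorant because
  \<open>p ^ (2 * s)\<close> divides \<open>H\<close>, and \<open>sum_maj\<close> gives the
  saving.\<close>

lemma sum_abs_corr_fact_sign:
  assumes p: "prime p" "odd p" and sr: "s \<le> r"
    and H: "p ^ (2 * s) dvd H" "H \<le> p ^ (2 * r)"
  shows "(\<Sum>h<H. \<Sum>h'<H. \<bar>\<Sum>y<p ^ (2 * r). fact_sign p (y+h) * fact_sign p (y+h')\<bar>)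
    \<le> (7/9) ^ s * (real H)\<^sup>2 * real p ^ (2 * r)"
proof -
  define Q where "Q = p ^ (2 * r)"
  have p0: "p > 0" using p(1) prime_gt_0_nat by blast
  have p3: "p \<ge> 3" using p prime_ge_2_nat[of p] by (cases "p = 2") auto
  have per: "trunc_sign p r (n + Q) = trunc_sign p r n" for n
    unfolding Q_def by (rule trunc_sign_periodic[OF p0])
  \<comment> \<open>Since \<open>y + h < 2 * Q\<close>, the part above the lowest
    \<open>2 * r\<close> digits is 0 or 1, and there the sign is 1.\<close>
  have trunc: "fact_sign p (y+h) = trunc_sign p r (y+h)" if "y < Q" "h < H" for y h
  proof -
    have "y + h < 2 * Q" using that H(2) by (simp add: Q_def)
    then have "(y + h) div Q < 2" by (rule less_mult_imp_div_less)
    then have "fact_sign p ((y + h) div Q) = 1" using p3 p(1) by (intro fact_sign_less) auto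
    then show ?thesis using fact_sign_trunc[OF p, of "y+h" r] by (simp add: Q_def)
  qed
  have corr: "(\<Sum>y<Q. fact_sign p (y+h) * fact_sign p (y+h')) =
      autocorr Q (trunc_sign p r) (h' + (Q*H - h))" if h: "h < H" "h' < H" for h h'
  proof -
    \<comment> \<open>This is \<open>h' - h\<close> made nonnegative by adding a multiple of the
      period \<open>Q\<close>.\<close>
    define D where "D = h' + (Q*H - h)"
    have "h \<le> Q*H" using h p0 by (simp add: Q_def) (metis le_trans less_imp_le mult_le_mono1 nat_mult_1 One_nat_def Suc_leI zero_less_power)
    then have D: "y + h + D = y + h' + Q*H" for y by (simp add: D_def)
    have "(\<Sum>y<Q. fact_sign p (y+h) * fact_sign p (y+h')) =
        (\<Sum>y<Q. trunc_sign p r (y+h) * trunc_sign p r (y+h+D))"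
      unfolding D periodic_mult[of "trunc_sign p r", OF per]
      using h by (intro sum.cong) (auto simp: trunc)
    also have "\<dots> = autocorr Q (trunc_sign p r) D"
    proof -
      have "trunc_sign p r (n + Q) * trunc_sign p r (n + Q + D) =
          trunc_sign p r n * trunc_sign p r (n + D)" for n
        using per[of n] per[of "n + D"] by (simp add: ac_simps)
      from sum_periodic_window[of "\<lambda>n. trunc_sign p r n * trunc_sign p r (n + D)" Q h 1, OF this]
      show ?thesis by (simp add: autocorr_def)
    qed
    finally show ?thesis by (simp add: D_def)
  qed
  have row: "(\<Sum>h'<H. \<bar>\<Sum>y<Q. fact_sign p (y+h) * fact_sign p (y+h')\<bar>)
      \<le> (7/9) ^ s * real H * real Q" if h: "h < H" for h
  proof -
    obtain K where K: "H = p ^ (2 * s) * K" using H(1) by blast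
    have "(\<Sum>h'<H. \<bar>\<Sum>y<Q. fact_sign p (y+h) * fact_sign p (y+h')\<bar>) \<le>
        (\<Sum>h'<H. real Q * maj p s (h' + (Q*H - h)))"
    proof (rule sum_mono)
      fix h' assume "h' \<in> {..<H}"
      then show "\<bar>\<Sum>y<Q. fact_sign p (y+h) * fact_sign p (y+h')\<bar> \<le>
          real Q * maj p s (h' + (Q*H - h))"
        using corr[OF h, of h'] autocorr_trunc_le_maj[OF p(2) sr, of "h' + (Q*H - h)"]
        by (simp add: Q_def)
    qed
    also have "\<dots> = real Q * (real K * (\<Sum>n<p ^ (2 * s). maj p s n))"
      using sum_periodic_window[of "maj p s" "p ^ (2 * s)" "Q*H - h" K] maj_periodic[OF p0]
      by (simp add: sum_distrib_left[symmetric] K)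
    also have "\<dots> \<le> real Q * (real K * ((7/9) ^ s * real p ^ (2 * s)))"
      by (intro mult_left_mono sum_maj p p3) auto
    also have "\<dots> = (7/9) ^ s * real H * real Q" by (simp add: K)
    finally show ?thesis .
  qed
  have "(\<Sum>h<H. \<Sum>h'<H. \<bar>\<Sum>y<Q. fact_sign p (y+h) * fact_sign p (y+h')\<bar>)
      \<le> (\<Sum>h<H. (7/9) ^ s * real H * real Q)"
    by (intro sum_mono row) auto
  also have "\<dots> = (7/9) ^ s * (real H)\<^sup>2 * real Q" by (simp add: power2_eq_square)
  finally show ?thesis by (simp add: Q_def)
qed

text \<open>After the square is expanded, the sum over the independent residues factors over
  \<open>P\<close>. One prime \<open>q\<close> of \<open>S\<close> yields the saving; every other
  factor is bounded by its number of residues.\<close>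

lemma second_moment:
  assumes P: "finite P" "\<And>p. p \<in> P \<Longrightarrow> prime p" "\<And>p. p \<in> P \<Longrightarrow> odd p"
    and sr: "s \<le> r"
    and H: "\<And>p. p \<in> P \<Longrightarrow> p ^ (2 * s) dvd H" "\<And>p. p \<in> P \<Longrightarrow> H \<le> p ^ (2 * r)"
    and S: "S \<subseteq> P" "S \<noteq> {}"
  defines "A \<equiv> PiE P (\<lambda>p. {..<p ^ (2 * r)})"
  shows "(\<Sum>a\<in>A. (\<Sum>h<H. \<Prod>p\<in>S. fact_sign p (a p + h))\<^sup>2)
    \<le> real (card A) * ((7/9) ^ s * (real H)\<^sup>2)"
proof -
  \<comment> \<open>The value 1 outside \<open>S\<close> lets the product run over all of
    \<open>P\<close>, as the factorisation over \<open>PiE\<close> requires.\<close>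
  define F where "F h h' p y = (if p \<in> S then fact_sign p (y+h) * fact_sign p (y+h') else 1)"
    for h h' p y
  define Z where "Z p = real p ^ (2 * r)" for p
  obtain q where q: "q \<in> S" "q \<in> P" using S by auto
  define c where "c h h' = \<bar>\<Sum>y<q ^ (2 * r). fact_sign q (y+h) * fact_sign q (y+h')\<bar>" for h h'
  have cardA: "real (card A) = Z q * (\<Prod>p\<in>P-{q}. Z p)"
    using P(1) q(2) by (simp add: A_def card_PiE Z_def prod.remove)
  have sq: "(\<Sum>h<H. \<Prod>p\<in>S. fact_sign p (a p + h))\<^sup>2 =
      (\<Sum>h<H. \<Sum>h'<H. \<Prod>p\<in>P. F h h' p (a p))" for a
  proof -
    have "(\<Prod>p\<in>P. F h h' p (a p)) =
        (\<Prod>p\<in>S. fact_sign p (a p + h)) * (\<Prod>p\<in>S. fact_sign p (a p + h'))" for h h'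
    proof -
      have "(\<Prod>p\<in>P. F h h' p (a p)) = (\<Prod>p\<in>P \<inter> S. fact_sign p (a p + h) * fact_sign p (a p + h'))"
        using P(1) by (simp add: F_def prod.inter_restrict)
      also have "P \<inter> S = S" using S by auto
      finally show ?thesis by (simp add: prod.distrib)
    qed
    then show ?thesis by (simp add: power2_eq_square sum_product)
  qed
  have pair: "(\<Sum>a\<in>A. \<Prod>p\<in>P. F h h' p (a p)) \<le> c h h' * (\<Prod>p\<in>P-{q}. Z p)" for h h'
  proof -
    have "(\<Sum>a\<in>A. \<Prod>p\<in>P. F h h' p (a p)) = (\<Prod>p\<in>P. \<Sum>y<p ^ (2 * r). F h h' p y)"
      unfolding A_def using P(1) by (intro prod_sum_PiE[symmetric]) auto
    also have "\<dots> \<le> (\<Prod>p\<in>P. \<bar>\<Sum>y<p ^ (2 * r). F h h' p y\<bar>)"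
      using abs_prod[of "\<lambda>p. \<Sum>y<p ^ (2 * r). F h h' p y" P]
      by (metis abs_ge_self)
    also have "\<dots> = c h h' * (\<Prod>p\<in>P-{q}. \<bar>\<Sum>y<p ^ (2 * r). F h h' p y\<bar>)"
      using P(1) q by (simp add: prod.remove[of P q] F_def c_def)
    also have "\<dots> \<le> c h h' * (\<Prod>p\<in>P-{q}. Z p)"
    proof (intro mult_left_mono prod_mono conjI abs_ge_zero)
      fix p
      have "\<bar>\<Sum>y<p ^ (2 * r). F h h' p y\<bar> \<le> (\<Sum>y<p ^ (2 * r). \<bar>F h h' p y\<bar>)" by (rule sum_abs)
      also have "\<dots> = (\<Sum>y<p ^ (2 * r). 1)"
        by (intro sum.cong) (auto simp: F_def abs_mult)
      finally show "\<bar>\<Sum>y<p ^ (2 * r). F h h' p y\<bar> \<le> Z p" by (simp add: Z_def)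
    qed (simp add: c_def)
    finally show ?thesis .
  qed
  have "(\<Sum>a\<in>A. (\<Sum>h<H. \<Prod>p\<in>S. fact_sign p (a p + h))\<^sup>2) =
      (\<Sum>h<H. \<Sum>h'<H. \<Sum>a\<in>A. \<Prod>p\<in>P. F h h' p (a p))"
    unfolding sq by (subst sum.swap, rule sum.cong[OF refl], rule sum.swap)
  also have "\<dots> \<le> (\<Sum>h<H. \<Sum>h'<H. c h h' * (\<Prod>p\<in>P-{q}. Z p))"
    by (intro sum_mono pair)
  also have "\<dots> = (\<Sum>h<H. \<Sum>h'<H. c h h') * (\<Prod>p\<in>P-{q}. Z p)"
    by (simp only: sum_distrib_right)
  also have "\<dots> \<le> ((7/9) ^ s * (real H)\<^sup>2 * Z q) * (\<Prod>p\<in>P-{q}. Z p)"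
    unfolding c_def Z_def using q P H sr
    by (intro mult_right_mono sum_abs_corr_fact_sign prod_nonneg) auto
  also have "\<dots> = real (card A) * ((7/9) ^ s * (real H)\<^sup>2)"
    by (simp add: cardA)
  finally show ?thesis .
qed

text \<open>If every \<open>a\<close> had a bad \<open>S\<close>, then the squares of all sums,
  weighted by \<open>4 ^ card P\<close>, would add up to at least \<open>card A * H^2\<close>. There
  are fewer than \<open>2 ^ card P\<close> sets \<open>S\<close>, so \<open>second_moment\<close>
  contradicts this; the base 8 is 2 times 4.\<close>

lemma exists_small_character_sums:
  assumes P: "finite P" "\<And>p. p \<in> P \<Longrightarrow> prime p" "\<And>p. p \<in> P \<Longrightarrow> odd p"
    and sr: "s \<le> r"
    and H: "\<And>p. p \<in> P \<Longrightarrow> p ^ (2 * s) dvd H" "\<And>p. p \<in> P \<Longrightarrow> H \<le> p ^ (2 * r)" "H > 0"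
    and small: "(8::real) ^ card P * (7/9) ^ s < 1"
  shows "\<exists>a\<in>PiE P (\<lambda>p. {..<p ^ (2 * r)}). \<forall>S\<subseteq>P. S \<noteq> {} \<longrightarrow>
    2 ^ card P * \<bar>\<Sum>h<H. \<Prod>p\<in>S. fact_sign p (a p + h)\<bar> < real H"
proof (rule ccontr)
  define A where "A = PiE P (\<lambda>p. {..<p ^ (2 * r)})"
  define W where "W a S = (\<Sum>h<H. \<Prod>p\<in>S. fact_sign p (a p + h))" for a S
  assume "\<not> ?thesis"
  then have bad: "\<exists>S\<in>Pow P - {{}}. real H \<le> 2 ^ card P * \<bar>W a S\<bar>" if "a \<in> A" for a
    using that unfolding A_def W_def by (force simp: not_less)
  have finA: "finite A" unfolding A_def using P(1) by (intro finite_PiE) auto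
  have cardA: "card A > 0"
    unfolding A_def using P by (auto simp: card_PiE intro!: prod_pos dest: prime_gt_0_nat)
  have ge: "(real H)\<^sup>2 \<le> (\<Sum>S\<in>Pow P - {{}}. 4 ^ card P * (W a S)\<^sup>2)" if a: "a \<in> A" for a
  proof -
    obtain S where S: "S \<in> Pow P - {{}}" "real H \<le> 2 ^ card P * \<bar>W a S\<bar>" using bad[OF a] by blast
    have "(real H)\<^sup>2 \<le> (2 ^ card P * \<bar>W a S\<bar>)\<^sup>2" using S(2) by (intro power_mono) auto
    also have "\<dots> = 4 ^ card P * (W a S)\<^sup>2"
    proof -
      have "((2::real) ^ card P)\<^sup>2 = 4 ^ card P"
        by (simp add: power2_eq_square flip: power_mult_distrib)
      then show ?thesis by (simp add: power_mult_distrib)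
    qed
    also have "\<dots> \<le> (\<Sum>S\<in>Pow P - {{}}. 4 ^ card P * (W a S)\<^sup>2)"
      using S(1) P(1) by (intro member_le_sum) auto
    finally show ?thesis .
  qed
  have "real (card A) * (real H)\<^sup>2 = (\<Sum>a\<in>A. (real H)\<^sup>2)" by simp
  also have "\<dots> \<le> (\<Sum>a\<in>A. \<Sum>S\<in>Pow P - {{}}. 4 ^ card P * (W a S)\<^sup>2)"
    by (intro sum_mono ge)
  also have "\<dots> = (\<Sum>S\<in>Pow P - {{}}. 4 ^ card P * (\<Sum>a\<in>A. (W a S)\<^sup>2))"
    by (subst sum.swap) (simp add: sum_distrib_left)
  also have "\<dots> \<le> (\<Sum>S\<in>Pow P - {{}}. 4 ^ card P * (real (card A) * ((7/9) ^ s * (real H)\<^sup>2)))"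
    unfolding A_def W_def using P H sr
    by (intro sum_mono mult_left_mono second_moment) auto
  also have "\<dots> \<le> 2 ^ card P * (4 ^ card P * (real (card A) * ((7/9) ^ s * (real H)\<^sup>2)))"
  proof -
    have "card (Pow P - {{}}) \<le> 2 ^ card P"
      using P(1) by (metis card_Diff1_le card_Pow)
    then have "real (card (Pow P - {{}})) \<le> 2 ^ card P"
      by (metis of_nat_le_iff of_nat_numeral of_nat_power)
    then show ?thesis by (simp only: sum_constant) (intro mult_right_mono, auto)
  qed
  also have "\<dots> = (8 ^ card P * (7/9) ^ s) * (real (card A) * (real H)\<^sup>2)"
  proof -
    have "(2::real) ^ card P * 4 ^ card P = 8 ^ card P" by (simp flip: power_mult_distrib)
    then show ?thesis by (simp add: ac_simps)
  qed
  also have "\<dots> < 1 * (real (card A) * (real H)\<^sup>2)"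
    using small cardA H(3) by (intro mult_strict_right_mono) auto
  finally show False by simp
qed

section \<open>Sign patterns and the Chinese remainder theorem\<close>

text \<open>The product of \<open>\<delta> p * x p h + 1\<close> over \<open>P\<close> vanishes
  unless \<open>h\<close> has the wanted pattern. In its expansion over subsets, summed over
  \<open>h\<close>, the empty set gives \<open>H\<close>, and the other
  \<open>2 ^ card P - 1\<close> sets cannot cancel it.\<close>

lemma exists_sign_pattern:
  fixes x :: "'a \<Rightarrow> nat \<Rightarrow> real"
  assumes P: "finite P" and H: "H > 0"
    and x: "\<And>p h. p \<in> P \<Longrightarrow> \<bar>x p h\<bar> = 1" and \<delta>: "\<And>p. p \<in> P \<Longrightarrow> \<bar>\<delta> p\<bar> = (1::real)"
    and small: "\<And>S. S \<subseteq> P \<Longrightarrow> S \<noteq> {} \<Longrightarrow> 2 ^ card P * \<bar>\<Sum>h<H. \<Prod>p\<in>S. x p h\<bar> < real H"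
  shows "\<exists>h<H. \<forall>p\<in>P. x p h = \<delta> p"
proof (rule ccontr)
  assume no: "\<not> ?thesis"
  define W where "W S = (\<Sum>h<H. \<Prod>p\<in>S. x p h)" for S
  have zero: "(\<Prod>p\<in>P. \<delta> p * x p h + 1) = 0" if h: "h < H" for h
  proof -
    obtain p where p: "p \<in> P" "x p h \<noteq> \<delta> p" using no h by blast
    then have "\<delta> p * x p h + 1 = 0" using x[OF p(1), of h] \<delta>[OF p(1)] by (auto simp: abs_if split: if_splits)
    then show ?thesis using P p(1) by (auto simp: prod_zero_iff)
  qed
  have "0 = (\<Sum>h<H. \<Prod>p\<in>P. \<delta> p * x p h + 1)" using zero by simp
  also have "\<dots> = (\<Sum>h<H. \<Sum>S\<in>Pow P. (\<Prod>p\<in>S. \<delta> p) * (\<Prod>p\<in>S. x p h))"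
    using P by (simp add: prod_add prod.distrib)
  also have "\<dots> = (\<Sum>S\<in>Pow P. (\<Prod>p\<in>S. \<delta> p) * W S)"
    by (subst sum.swap) (simp add: W_def sum_distrib_left)
  also have "\<dots> = real H + (\<Sum>S\<in>Pow P - {{}}. (\<Prod>p\<in>S. \<delta> p) * W S)"
    using P by (subst sum.remove[of _ "{}"]) (auto simp: W_def)
  finally have "real H = - (\<Sum>S\<in>Pow P - {{}}. (\<Prod>p\<in>S. \<delta> p) * W S)" by simp
  also have "\<dots> \<le> (\<Sum>S\<in>Pow P - {{}}. \<bar>(\<Prod>p\<in>S. \<delta> p) * W S\<bar>)"
    using sum_abs[of "\<lambda>S. (\<Prod>p\<in>S. \<delta> p) * W S" "Pow P - {{}}"] by linarith
  also have "\<dots> \<le> (\<Sum>S\<in>Pow P - {{}}. real H / 2 ^ card P)"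
  proof (rule sum_mono)
    fix S assume S: "S \<in> Pow P - {{}}"
    then have "\<bar>\<Prod>p\<in>S. \<delta> p\<bar> = 1" using \<delta> by (simp add: abs_prod subset_iff)
    then show "\<bar>(\<Prod>p\<in>S. \<delta> p) * W S\<bar> \<le> real H / 2 ^ card P"
      using small[of S] S by (simp add: abs_mult W_def field_simps)
  qed
  also have "\<dots> = (2 ^ card P - 1) * (real H / 2 ^ card P)"
    using P by (simp add: card_Pow of_nat_diff)
  also have "\<dots> < real H" using H by (simp add: field_simps)
  finally show False by simp
qed

text \<open>The low block has the even length \<open>2 * r\<close>, so the digits of
  \<open>t\<close> keep the parity of their positions and the signs of the two blocks
  multiply.\<close>

lemma fact_sign_add:
  assumes "prime p" "odd p" "y < p ^ (2 * r)"
  shows "fact_sign p (y + p ^ (2 * r) * t) = fact_sign p y * fact_sign p t"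
proof -
  have p0: "p > 0" using assms(1) prime_gt_0_nat by blast
  have "trunc_sign p r (y + p ^ (2 * r) * t) = trunc_sign p r y"
    by (rule periodic_mult) (rule trunc_sign_periodic[OF p0])
  moreover have "(y + p ^ (2 * r) * t) div p ^ (2 * r) = t"
    using p0 assms(3) by (subst div_mult_self2) auto
  ultimately show ?thesis
    using fact_sign_trunc[OF assms(1,2), of "y + p ^ (2 * r) * t" r]
      fact_sign_trunc[OF assms(1,2), of y r] fact_sign_less[OF assms(1) p0] assms(3)
    by simp
qed

lemma exists_fact_sign_pattern:
  fixes \<delta> :: "nat \<Rightarrow> real"
  assumes P: "finite P" "\<And>p. p \<in> P \<Longrightarrow> prime p" "\<And>p. p \<in> P \<Longrightarrow> odd p"
    and k: "card P = k" "k > 0" and b: "b > 0" "\<And>p. p \<in> P \<Longrightarrow> p \<le> 2 ^ b"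
    and \<delta>: "\<And>p. p \<in> P \<Longrightarrow> \<bar>\<delta> p\<bar> = 1"
  shows "\<exists>n. 0 < n \<and> n < 2 ^ (b * (36 * k\<^sup>2 * b + 2) * k + 2) \<and> (\<forall>p\<in>P. fact_sign p n = \<delta> p)"
proof -
  \<comment> \<open>9 is the least exponent with \<open>8 * (7/9) ^ 9 < 1\<close>.\<close>
  define s where "s = 9 * k"
  define H where "H = (\<Prod>p\<in>P. p ^ (2 * s))"
  \<comment> \<open>Equal to \<open>b * (2 * s) * k\<close>, so that \<open>H\<close> is at most
    \<open>2 ^ r\<close>, hence at most \<open>p ^ (2 * r)\<close>.\<close>
  define r where "r = 18 * k\<^sup>2 * b"
  define M where "M = (\<Prod>p\<in>P. p ^ (2 * Suc r))"
  have p0: "p > 0" if "p \<in> P" for p using P(2)[OF that] by (rule prime_gt_0_nat)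
  have p2: "2 \<le> p" if "p \<in> P" for p using P(2)[OF that] by (rule prime_ge_2_nat)
  have prod_le: "(\<Prod>p\<in>P. p ^ j) \<le> 2 ^ (b * j * k)" for j
  proof -
    have "(\<Prod>p\<in>P. p ^ j) \<le> (\<Prod>p\<in>P. (2 ^ b) ^ j)"
      by (intro prod_mono conjI power_mono b) auto
    then show ?thesis using k by (simp add: power_mult)
  qed
  have sr: "s \<le> r" using k(2) b(1) by (auto simp: s_def r_def power2_eq_square)
  have H0: "H > 0" and M0: "M > 0" unfolding H_def M_def using p0 by (auto intro!: prod_pos)
  have HM: "H \<le> M" unfolding H_def M_def using p0 sr
    by (intro prod_mono conjI power_increasing) (auto simp: Suc_leI)
  have Hr: "H \<le> p ^ (2 * r)" if "p \<in> P" for p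
  proof -
    have "H \<le> 2 ^ (b * (2 * s) * k)" unfolding H_def by (rule prod_le)
    also have "b * (2 * s) * k = r" by (simp add: s_def r_def power2_eq_square)
    also have "(2::nat) ^ r \<le> p ^ r" using p2[OF that] by (intro power_mono) auto
    also have "\<dots> \<le> p ^ (2 * r)" using p0[OF that] by (intro power_increasing) auto
    finally show ?thesis .
  qed
  have dvd: "p ^ (2 * s) dvd H" if "p \<in> P" for p
    unfolding H_def using P(1) that by (rule dvd_prodI)
  have "(8::real) ^ card P * (7/9) ^ s = (8 * (7/9) ^ 9) ^ k"
    by (simp add: k s_def power_mult power_mult_distrib)
  also have "\<dots> < 1"
  proof -
    have "8 * (7/9) ^ 9 < (1::real)" by (simp add: power_divide)
    then show ?thesis using k(2) by (subst power_less_one_iff) auto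
  qed
  finally have small: "(8::real) ^ card P * (7/9) ^ s < 1" .
  obtain a where a: "a \<in> PiE P (\<lambda>p. {..<p ^ (2 * r)})"
    and sums: "\<And>S. S \<subseteq> P \<Longrightarrow> S \<noteq> {} \<Longrightarrow>
      2 ^ card P * \<bar>\<Sum>h<H. \<Prod>p\<in>S. fact_sign p (a p + h)\<bar> < real H"
    using exists_small_character_sums[OF P sr dvd Hr H0 small] by blast
  have ap: "a p < p ^ (2 * r)" if "p \<in> P" for p using a that by auto
  have cop: "\<forall>p\<in>P. \<forall>q\<in>P. p \<noteq> q \<longrightarrow> coprime (p ^ (2 * Suc r)) (q ^ (2 * Suc r))"
    using P(2) primes_coprime by (metis coprime_power_left_iff coprime_power_right_iff)
  have nz: "\<forall>p\<in>P. p ^ (2 * Suc r) \<noteq> 0" using p0 by auto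
  have "\<exists>!n0. n0 < M \<and> (\<forall>p\<in>P. [n0 = a p] (mod p ^ (2 * Suc r)))"
    unfolding M_def by (rule chinese_remainder_unique_nat[OF P(1) nz cop])
  then obtain n0 where n0: "n0 < M" "\<And>p. p \<in> P \<Longrightarrow> [n0 = a p] (mod p ^ (2 * Suc r))" by blast
  \<comment> \<open>Adding \<open>M\<close> keeps all the residues and makes the result
    positive.\<close>
  define m where "m = n0 + M"
  define t where "t p = m div p ^ (2 * Suc r)" for p
  have m: "m = a p + p ^ (2 * Suc r) * t p" if "p \<in> P" for p
  proof -
    have "p ^ (2 * Suc r) dvd M" unfolding M_def using P(1) that by (rule dvd_prodI)
    then have "m mod p ^ (2 * Suc r) = n0 mod p ^ (2 * Suc r)"
      unfolding m_def by (metis add.right_neutral mod_add_right_eq dvd_imp_mod_0)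
    also have "\<dots> = a p mod p ^ (2 * Suc r)" using n0(2)[OF that] by (simp add: cong_def)
    also have "\<dots> = a p"
    proof (rule mod_less)
      have "p ^ (2 * r) \<le> p ^ (2 * Suc r)" using p0[OF that] by (intro power_increasing) auto
      then show "a p < p ^ (2 * Suc r)" using ap[OF that] by (rule less_le_trans[rotated])
    qed
    finally show ?thesis unfolding t_def by (metis mod_mult_div_eq)
  qed
  \<comment> \<open>The sign of the high part \<open>t p\<close> is built into the target; it
    cancels below as a square.\<close>
  obtain h where h: "h < H" "\<forall>p\<in>P. fact_sign p (a p + h) = \<delta> p * fact_sign p (t p)"
    using exists_sign_pattern[OF P(1) H0, of "\<lambda>p h. fact_sign p (a p + h)"
        "\<lambda>p. \<delta> p * fact_sign p (t p)"] sums \<delta>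
    by (auto simp: abs_mult)
  have "fact_sign p (m + h) = \<delta> p" if "p \<in> P" for p
  proof -
    \<comment> \<open>The two zero digits above \<open>a p\<close> absorb the carry, so adding
      \<open>h\<close> leaves \<open>t p\<close> unchanged.\<close>
    have "a p + h < 2 * p ^ (2 * r)" using ap[OF that] h(1) Hr[OF that] by linarith
    also have "\<dots> \<le> p * p * p ^ (2 * r)"
      using mult_le_mono[OF p2[OF that] p0[OF that, unfolded Suc_le_eq[symmetric]]]
      by (intro mult_le_mono1) simp
    finally have lt: "a p + h < p ^ (2 * Suc r)" by simp
    have "m + h = (a p + h) + p ^ (2 * Suc r) * t p" using m[OF that] by linarith
    then have "fact_sign p (m + h) = fact_sign p (a p + h) * fact_sign p (t p)"
      using fact_sign_add[OF P(2,3)[OF that] lt] by (simp only:)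
    also have "\<dots> = \<delta> p * (fact_sign p (t p) * fact_sign p (t p))" using h(2) that by simp
    also have "fact_sign p (t p) * fact_sign p (t p) = 1"
      using abs_mult_self[of "fact_sign p (t p)"] by simp
    finally show ?thesis by simp
  qed
  moreover have "0 < m + h" using M0 by (simp add: m_def)
  moreover have "m + h < 2 ^ (b * (36 * k\<^sup>2 * b + 2) * k + 2)"
  proof -
    have "m + h < 4 * M" using n0(1) h(1) HM by (simp add: m_def)
    also have "M \<le> 2 ^ (b * (2 * Suc r) * k)" unfolding M_def by (rule prod_le)
    also have "2 * Suc r = 36 * k\<^sup>2 * b + 2" by (simp add: r_def)
    finally show ?thesis by (simp add: power_add)
  qed
  ultimately show ?thesis by blast
qed

section \<open>Size of the odd primes\<close>

text \<open>Erdos' argument: every positive integer is a square times a product of distinct primes.\<close>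
lemma card_primes_le_power4: "m \<le> card {p::nat. prime p \<and> p \<le> 4 ^ m}"
proof -
  define A where "A = {p::nat. prime p \<and> p \<le> 4 ^ m}"
  have finA: "finite A" unfolding A_def by (rule finite_subset[of _ "{..4 ^ m}"]) auto
  \<comment> \<open>This pair determines \<open>n\<close>; up to \<open>4 ^ m\<close> there are at
    most \<open>2 ^ m\<close> square parts and \<open>2 ^ card A\<close> sets of primes.\<close>
  define f where "f n = (square_part n, prime_factors (squarefree_part n))" for n :: nat
  have inj: "inj_on f {1..4 ^ m}"
  proof (rule inj_onI)
    fix x y :: nat assume xy: "x \<in> {1..4 ^ m}" "y \<in> {1..4 ^ m}" "f x = f y"
    have sq: "squarefree_part n = \<Prod>(prime_factors (squarefree_part n))" for n :: nat
    proof -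
      have "squarefree_part n > 0" by (rule gr0I) simp
      then show ?thesis
        using squarefree_factorial_semiring'[of "squarefree_part n"]
        by (subst prime_factorization_nat[of "squarefree_part n"]) (auto intro!: prod.cong)
    qed
    have "squarefree_part x = squarefree_part y" using xy(3) sq unfolding f_def by (metis prod.inject)
    moreover have "square_part x = square_part y" using xy(3) by (simp add: f_def)
    ultimately show "x = y" using squarefree_decompose by metis
  qed
  have img: "f ` {1..4 ^ m} \<subseteq> {1..2 ^ m} \<times> Pow A"
  proof (rule image_subsetI)
    fix n :: nat assume n: "n \<in> {1..4 ^ m}"
    have "(square_part n)\<^sup>2 \<le> n" using n by (intro dvd_imp_le) auto
    also have "n \<le> (2 ^ m)\<^sup>2" using n by (simp add: power2_eq_square flip: power_mult_distrib)
    finally have "square_part n \<le> 2 ^ m" by (rule power2_le_imp_le) simp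
    moreover have "1 \<le> square_part n" using n by (auto simp: Suc_le_eq intro!: gr0I)
    moreover have "prime_factors (squarefree_part n) \<subseteq> A"
    proof
      fix p assume p: "p \<in> prime_factors (squarefree_part n)"
      have "squarefree_part n dvd n" using squarefree_decompose[of n] by (metis dvd_triv_left)
      then have "p dvd n" using p by (meson dvd_trans in_prime_factors_imp_dvd)
      then have "p \<le> n" using n by (intro dvd_imp_le) auto
      then show "p \<in> A" using p n by (auto simp: A_def in_prime_factors_imp_prime)
    qed
    ultimately show "f n \<in> {1..2 ^ m} \<times> Pow A" by (simp add: f_def)
  qed
  have "4 ^ m = card (f ` {1..4 ^ m})" using card_image[OF inj] by simp
  also have "\<dots> \<le> card ({1..2 ^ m::nat} \<times> Pow A)"
    using finA by (intro card_mono img) auto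
  also have "\<dots> = 2 ^ m * 2 ^ card A" using finA by (simp add: card_cartesian_product card_Pow)
  finally have "(4::nat) ^ m \<le> 2 ^ m * 2 ^ card A" .
  moreover have "(4::nat) ^ m = 2 ^ m * 2 ^ m" by (simp flip: power_mult_distrib)
  ultimately have "(2::nat) ^ m \<le> 2 ^ card A" by simp
  then show ?thesis unfolding A_def by (simp only: power_increasing_iff)
qed

lemma infinite_odd_primes: "infinite {p::nat. prime p \<and> odd p}"
proof
  assume "finite {p::nat. prime p \<and> odd p}"
  then have "finite (insert 2 {p::nat. prime p \<and> odd p})" by simp
  moreover have "{p::nat. prime p} \<subseteq> insert 2 {p. prime p \<and> odd p}"
  proof
    fix p :: nat assume "p \<in> {p. prime p}"
    then show "p \<in> insert 2 {p. prime p \<and> odd p}"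
      using prime_ge_2_nat[of p] prime_odd_nat[of p] by (cases "p = 2") auto
  qed
  ultimately show False using primes_infinite finite_subset by blast
qed

lemma odd_prime_prime: "prime (odd_prime i)" and odd_prime_odd: "odd (odd_prime i)"
  using enumerate_in_set[OF infinite_odd_primes, of "i - 1"] by (auto simp: odd_prime_def)

lemma inj_on_odd_prime: "inj_on odd_prime {1..}"
proof (rule inj_onI)
  fix i j :: nat assume ij: "i \<in> {1..}" "j \<in> {1..}" "odd_prime i = odd_prime j"
  then have "i - 1 = j - 1"
    using injD[OF inj_enumerate[OF infinite_odd_primes]] by (simp add: odd_prime_def)
  then show "i = j" using ij by auto
qed

text \<open>There are at least \<open>i + 1\<close> primes up to \<open>4 ^ Suc i\<close>. If the
  \<open>i\<close>-th odd prime were larger, only 2 and the first \<open>i - 1\<close> odd primes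
  could be among them.\<close>

lemma odd_prime_le:
  assumes "i \<ge> 1"
  shows "odd_prime i \<le> 4 ^ Suc i"
proof (rule ccontr)
  define S where "S = {p::nat. prime p \<and> odd p}"
  define E where "E = {p::nat. prime p \<and> p \<le> 4 ^ Suc i}"
  assume big: "\<not> ?thesis"
  have "E \<subseteq> insert 2 (enumerate S ` {..<i-1})"
  proof
    fix p assume p: "p \<in> E"
    show "p \<in> insert 2 (enumerate S ` {..<i-1})"
    proof (cases "odd p")
      case True
      then have "p \<in> S" using p by (simp add: S_def E_def)
      then obtain j where j: "enumerate S j = p"
        using enumerate_Ex infinite_odd_primes unfolding S_def by blast
      have "enumerate S j < enumerate S (i - 1)"
        using big p j by (simp add: odd_prime_def S_def E_def)
      then have "j < i - 1" using infinite_odd_primes by (simp add: S_def)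
      then show ?thesis using j by auto
    next
      case False
      then show ?thesis using p prime_odd_nat[of p] prime_ge_2_nat[of p] by (force simp: E_def)
    qed
  qed
  then have "card E \<le> card (insert 2 (enumerate S ` {..<i-1}))" by (intro card_mono) auto
  also have "\<dots> \<le> Suc (card (enumerate S ` {..<i-1}))" by (rule card_insert_le_m1) auto
  also have "\<dots> \<le> Suc (i - 1)" using card_image_le[of "{..<i-1}" "enumerate S"] by simp
  finally show False using card_primes_le_power4[of "Suc i"] assms by (simp add: E_def)
qed

section \<open>Comparison with the required range\<close>

text \<open>The hypothesis makes \<open>ln (ln x)\<close> at least 1, so dividing by its sixth power
  only decreases the argument of the ninth root.\<close>

lemma k_fun_power_le:
  assumes "ln x \<ge> exp 1"
  shows "real (k_fun 1 x) ^ 9 \<le> ln x"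
proof -
  define L where "L = ln x"
  have L: "L > 0" "ln L \<ge> 1"
  proof -
    show "L > 0" using assms by (simp add: L_def less_le_trans[OF exp_gt_zero])
    then show "ln L \<ge> 1" using assms by (simp add: L_def ln_ge_iff)
  qed
  have "L / ln L ^ 6 \<le> L"
    using L by (simp add: divide_le_eq mult_left_le_one_le one_le_power)
  then have "(L / ln L ^ 6) powr (1/9) \<le> L powr (1/9)" using L by (intro powr_mono2) auto
  moreover have "real (k_fun 1 x) \<le> (L / ln L ^ 6) powr (1/9)"
    unfolding k_fun_def L_def by (simp add: of_nat_nat)
  ultimately have "real (k_fun 1 x) ^ 9 \<le> (L powr (1/9)) ^ 9" by (intro power_mono) auto
  also have "\<dots> = L" using L by (simp add: powr_powr flip: powr_realpow)
  finally show ?thesis by (simp add: L_def)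
qed

theorem theorem2:
  shows "\<exists>c1::real. c1 > 0 \<and>
    (\<forall>\<epsilon> :: nat \<Rightarrow> nat. (\<forall>i\<ge>1. \<epsilon> i \<in> {0, 1}) \<longrightarrow>
      (\<forall>\<^sub>F x in at_top. \<exists>n::nat. 0 < n \<and> real n < x \<and>
         (\<forall>i\<in>{1..k_fun c1 x}. e_fact (odd_prime i) n mod 2 = \<epsilon> i)))"
proof (intro exI[of _ 1] conjI allI impI)
  fix \<epsilon> :: "nat \<Rightarrow> nat"
  assume \<epsilon>: "\<forall>i\<ge>1. \<epsilon> i \<in> {0, 1}"
  show "\<forall>\<^sub>F x in at_top. \<exists>n::nat. 0 < n \<and> real n < x \<and>
         (\<forall>i\<in>{1..k_fun 1 x}. e_fact (odd_prime i) n mod 2 = \<epsilon> i)"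
    using eventually_ge_at_top[of "exp (10 ^ 6)"]
  proof eventually_elim
    case (elim x)
    define k where "k = k_fun 1 x"
    have x1: "x > 1" using elim by (meson less_le_trans one_less_exp_iff zero_less_numeral zero_less_power)
    have L: "ln x \<ge> 10 ^ 6" using elim x1 by (simp add: ln_ge_iff)
    show ?case
    proof (cases "k = 0")
      \<comment> \<open>No congruence is imposed, so \<open>n = 1\<close> serves.\<close>
      case True
      then show ?thesis using x1 by (intro exI[of _ 1]) (auto simp: k_def)
    next
      case False
      have "exp 1 \<le> (10::real) ^ 6" using exp_le by (rule order_trans) simp
      then have k9: "real k ^ 9 \<le> ln x" unfolding k_def using L by (intro k_fun_power_le) simp
      define P where "P = odd_prime ` {1..k}"
      define \<delta> :: "nat \<Rightarrow> real" where "\<delta> p = (-1) ^ \<epsilon> (inv_into {1..k} odd_prime p)" for p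
      have inj: "inj_on odd_prime {1..k}" by (rule inj_on_subset[OF inj_on_odd_prime]) auto
      have bound: "p \<le> 2 ^ (4 * k)" if p: "p \<in> P" for p
      proof -
        obtain i where i: "i \<in> {1..k}" "p = odd_prime i" using p by (auto simp: P_def)
        have "p \<le> 4 ^ Suc i" using i odd_prime_le[of i] by simp
        also have "(4::nat) ^ Suc i = 2 ^ (2 * Suc i)" by (simp add: power_mult)
        also have "\<dots> \<le> 2 ^ (4 * k)" using i by (intro power_increasing) auto
        finally show ?thesis .
      qed
      \<comment> \<open>The bound of \<open>exists_fact_sign_pattern\<close> with
        \<open>b = 4 * k\<close>.\<close>
      define B where "B = 4 * k * (36 * k\<^sup>2 * (4 * k) + 2) * k + 2"
      have "\<exists>n. 0 < n \<and> n < 2 ^ B \<and> (\<forall>p\<in>P. fact_sign p n = \<delta> p)"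
        unfolding B_def
      proof (rule exists_fact_sign_pattern)
        show "card P = k" unfolding P_def using inj by (simp add: card_image)
        show "\<And>p. p \<in> P \<Longrightarrow> prime p" "\<And>p. p \<in> P \<Longrightarrow> odd p"
          by (auto simp: P_def odd_prime_prime odd_prime_odd)
      qed (use bound False in \<open>auto simp: P_def \<delta>_def power_abs\<close>)
      then obtain n where n: "0 < n" "n < 2 ^ B" "\<forall>p\<in>P. fact_sign p n = \<delta> p" by blast
      have "real B \<le> ln x"
      proof -
        have "k\<^sup>2 \<le> k ^ 5" "1 \<le> k ^ 5" using False by (auto intro: power_increasing simp: Suc_leI)
        moreover have "B = 576 * k ^ 5 + 8 * k\<^sup>2 + 2"
        proof -
          have "k ^ 5 = k * k * k * k * k" by (simp add: eval_nat_numeral)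
          then show ?thesis by (simp add: B_def power2_eq_square algebra_simps)
        qed
        ultimately have B: "B \<le> 586 * k ^ 5" by linarith
        show ?thesis
        proof (cases "k \<ge> 5")
          case True
          \<comment> \<open>\<open>5 ^ 4 = 625\<close> exceeds 586, so from \<open>k = 5\<close> on
            the ninth power dominates.\<close>
          then have "5 ^ 4 * k ^ 5 \<le> k ^ 4 * k ^ 5" by (intro mult_le_mono1 power_mono) auto
          also have "\<dots> = k ^ 9" by (simp flip: power_add)
          finally have "B \<le> k ^ 9" using B by simp
          then have "real B \<le> real k ^ 9" by (metis of_nat_le_iff of_nat_power)
          then show ?thesis using k9 by (rule order_trans)
        next
          case False
          \<comment> \<open>For \<open>k\<close> at most 4, \<open>B\<close> is at most
            \<open>586 * 4 ^ 5 = 600064\<close>; the threshold \<open>exp (10 ^ 6)\<close> for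
            \<open>x\<close> covers this.\<close>
          then have "k ^ 5 \<le> 4 ^ 5" by (intro power_mono) auto
          then have "B \<le> 10 ^ 6" using B by simp
          then have "real B \<le> 10 ^ 6" by (metis of_nat_le_iff of_nat_numeral of_nat_power)
          then show ?thesis using L by simp
        qed
      qed
      have "real n < 2 ^ B" using n(2) by (metis of_nat_less_iff of_nat_numeral of_nat_power)
      also have "\<dots> \<le> exp 1 ^ B" using exp_ge_add_one_self[of 1] by (intro power_mono) auto
      also have "\<dots> = exp (real B)" by (simp flip: exp_of_nat_mult)
      also have "\<dots> \<le> exp (ln x)" using \<open>real B \<le> ln x\<close> by simp
      also have "\<dots> = x" using x1 by simp
      finally have "real n < x" .
      moreover have "e_fact (odd_prime i) n mod 2 = \<epsilon> i" if i: "i \<in> {1..k}" for i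
      proof -
        have "(-1::real) ^ e_fact (odd_prime i) n = (-1) ^ \<epsilon> i"
          using n(3) i inj by (auto simp: P_def \<delta>_def fact_sign_def)
        then have "even (e_fact (odd_prime i) n) = even (\<epsilon> i)"
          by (auto simp: minus_one_power_iff split: if_splits)
        then show ?thesis using \<epsilon> i by (auto simp: even_iff_mod_2_eq_zero odd_iff_mod_2_eq_one)
      qed
      ultimately show ?thesis using n(1) unfolding k_def by blast
    qed
  qed
qed simp

end
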